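(* Let $E\subseteq\mathbb R$ be a set such that for every sequence $\{\alpha_m\}_{m=1}^\infty$ of real numbers strictly decreasing to $0$, there exist $t\in\mathbb R$ and $\delta\neq 0$ such that $t+\delta\alpha_m\in E$ for all $m\ge 1$. Then $E$ is somewhere dense.
   Context: A set $S\subseteq\mathbb R$ is called somewhere dense if its closure $\overline S$ (in the standard topology of $\mathbb R$) contains an interval. All intervals are nondegenerate, i.e. have positive length. *)

theory Defs
  imports "HOL-Analysis.Analysis"
begin

text \<open>Intervals are nondegenerate, i.e. have positive length. Here \<^const>\<open>is_interval\<close> also holds
  of the empty set and of singletons, so the two distinct points are required explicitly. The
  interval may be open, closed, half-open or unbounded.\<close>

definition nondegenerate_interval :: "real set \<Rightarrow> bool" where
  "nondegenerate_interval I \<longleftrightarrow> is_interval I \<and> (\<exists>x\<in>I. \<exists>y\<in>I. x < y)"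

definition somewhere_dense :: "real set \<Rightarrow> bool" where
  "somewhere_dense S \<longleftrightarrow> (\<exists>I. nondegenerate_interval I \<and> I \<subseteq> closure S)"

end

theory Submission
  imports Defs
begin

text \<open>
  The proof is by contraposition: if the closure of \<open>E\<close> has empty interior, there is a sequence
  \<open>\<alpha>\<close> decreasing to \<open>0\<close> so slowly that no affine copy \<open>t + \<delta> \<alpha>\<close> fits into \<open>E\<close>.

  A nowhere dense set has holes of a uniform size on compact sets
  (\<open>uniform_holes_on_compact\<close>). Fix a scale \<open>x > 0\<close> and let \<open>(t, \<delta>)\<close> range over the compact
  set \<open>\<bar>t\<bar> \<le> 1/x\<close>, \<open>x \<le> \<bar>\<delta>\<bar> \<le> 1/x\<close>. Pulling \<open>E\<close> back along \<open>y \<mapsto> t + \<delta> y\<close> yields a set that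
  misses some subinterval of \<open>(0, x)\<close> whose length is bounded below by a positive number
  depending on \<open>E\<close> and \<open>x\<close> only (\<open>hole_radius_exists\<close>). As \<open>x\<close> decreases, more pairs \<open>(t, \<delta>)\<close> have to be
  served inside a shorter interval, so half of the supremum of such bounds is monotone in \<open>x\<close>; it is used
  as a step size \<open>h\<close>: put \<open>\<alpha> (k + 1) = \<alpha> k - h (\<alpha> k)\<close>. Monotonicity of \<open>h\<close> forces \<open>\<alpha>\<close> to tend
  to \<open>0\<close>, and forces all steps after \<open>\<alpha> k\<close> to be at most \<open>h (\<alpha> k)\<close>; therefore the sequence cannot
  jump over a hole of the scale \<open>\<alpha> k\<close> (\<open>fine_decreasing_sequence\<close>). Every pair \<open>(t, \<delta>)\<close> with
  \<open>\<delta> \<noteq> 0\<close> is admitted at the scale \<open>\<alpha> k\<close> once \<open>k\<close> is large, so \<open>t + \<delta> \<alpha> j \<notin> E\<close> for some \<open>j > k\<close>.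
\<close>

lemma interior_closure_empty_if_not_somewhere_dense:
  assumes "\<not> somewhere_dense E"
  shows "interior (closure E) = {}"
proof (rule ccontr)
  assume "interior (closure E) \<noteq> {}"
  then obtain x e where e: "e > 0" "ball x e \<subseteq> closure E"
    by (auto simp: mem_interior)
  have "nondegenerate_interval (ball x e)"
    unfolding nondegenerate_interval_def
  proof
    show "is_interval (ball x e)"
      by (simp add: ball_eq_greaterThanLessThan)
    show "\<exists>a\<in>ball x e. \<exists>b\<in>ball x e. a < b"
      using e(1) by (intro bexI[of _ x] bexI[of _ "x + e/2"]) (auto simp: dist_real_def)
  qed
  with e assms show False
    unfolding somewhere_dense_def by blast
qed

text \<open>Finitely many balls of radius \<open>\<epsilon>/2\<close> cover \<open>K\<close>; each of them contains a hole of \<open>E\<close>, and the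
  ball of radius \<open>\<epsilon>\<close> about a point of \<open>K\<close> contains one of these finitely many balls.\<close>

lemma uniform_holes_on_compact:
  fixes E K :: "'a::metric_space set"
  assumes nd: "interior (closure E) = {}" and K: "compact K" and "\<epsilon> > 0"
  shows "\<exists>\<eta>>0. \<forall>m\<in>K. \<exists>c. ball c \<eta> \<subseteq> ball m \<epsilon> - E"
proof -
  have "\<exists>c r. r > 0 \<and> ball c r \<subseteq> ball p (\<epsilon>/2) - E" for p
  proof -
    have "p \<in> ball p (\<epsilon>/2)"
      using \<open>\<epsilon> > 0\<close> by simp
    then have "\<not> ball p (\<epsilon>/2) \<subseteq> closure E"
      using nd interior_maximal[OF _ open_ball] by blast
    then obtain c where "c \<in> ball p (\<epsilon>/2) - closure E"
      by blast
    moreover have "open (ball p (\<epsilon>/2) - closure E)"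
      by (intro open_Diff) auto
    ultimately obtain r where "r > 0" "ball c r \<subseteq> ball p (\<epsilon>/2) - closure E"
      by (meson open_contains_ball)
    then show ?thesis
      using closure_subset[of E] by blast
  qed
  then obtain c r where cr: "\<And>p. r p > (0::real)" "\<And>p. ball (c p) (r p) \<subseteq> ball p (\<epsilon>/2) - E"
    by metis
  obtain F where F: "finite F" "K \<subseteq> (\<Union>p\<in>F. ball p (\<epsilon>/2))"
    using K \<open>\<epsilon> > 0\<close> compact_imp_seq_compact[OF K] seq_compact_imp_totally_bounded[of K]
    by (metis half_gt_zero)
  \<comment> \<open>The \<open>1\<close> only keeps the minimum defined when \<open>K\<close>, and hence possibly \<open>F\<close>, is empty.\<close>
  define \<eta> where "\<eta> = Min (insert 1 (r ` F))"
  have "\<eta> > 0"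
    unfolding \<eta>_def using F(1) cr(1) by (subst Min_gr_iff) auto
  moreover have "\<exists>c. ball c \<eta> \<subseteq> ball m \<epsilon> - E" if m: "m \<in> K" for m
  proof -
    obtain p where p: "p \<in> F" "dist p m < \<epsilon>/2"
      using F(2) m by auto
    have "\<eta> \<le> r p"
      unfolding \<eta>_def using F(1) p(1) by (intro Min_le) auto
    then have "ball (c p) \<eta> \<subseteq> ball p (\<epsilon>/2) - E"
      using cr(2)[of p] subset_ball by blast
    moreover have "ball p (\<epsilon>/2) \<subseteq> ball m \<epsilon>"
    proof
      fix y assume "y \<in> ball p (\<epsilon>/2)"
      then show "y \<in> ball m \<epsilon>"
        using p(2) dist_triangle[of m y p] by (simp add: dist_commute)
    qed
    ultimately show ?thesis
      by blast
  qed
  ultimately show ?thesis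
    by blast
qed

text \<open>The single parameter \<open>x\<close> bounds the translations and dilations in play and also the
  place where a hole has to be found. This makes the condition easier to meet for larger \<open>x\<close>.\<close>

definition hole_radius :: "real set \<Rightarrow> real \<Rightarrow> real \<Rightarrow> bool" where
  "hole_radius E x \<eta> \<longleftrightarrow> (\<forall>t \<delta>. \<bar>t\<bar> \<le> 1/x \<longrightarrow> x \<le> \<bar>\<delta>\<bar> \<longrightarrow> \<bar>\<delta>\<bar> \<le> 1/x \<longrightarrow>
     (\<exists>v. ball v \<eta> \<subseteq> {0<..<x} - {y. t + \<delta> * y \<in> E}))"

lemma hole_radius_mono:
  assumes "hole_radius E x \<eta>" "0 < x" "x \<le> x'" "\<eta>' \<le> \<eta>"
  shows "hole_radius E x' \<eta>'"
  unfolding hole_radius_def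
proof (intro allI impI)
  fix t \<delta> :: real
  assume "\<bar>t\<bar> \<le> 1/x'" "x' \<le> \<bar>\<delta>\<bar>" "\<bar>\<delta>\<bar> \<le> 1/x'"
  moreover have "1/x' \<le> 1/x"
    using assms by (simp add: frac_le)
  ultimately obtain v where "ball v \<eta> \<subseteq> {0<..<x} - {y. t + \<delta> * y \<in> E}"
    using assms(1,3) unfolding hole_radius_def by (meson order_trans)
  moreover have "ball v \<eta>' \<subseteq> ball v \<eta>" "{0<..<x} \<subseteq> {0<..<x'}"
    using assms(3,4) by (auto simp: subset_ball)
  ultimately show "\<exists>v. ball v \<eta>' \<subseteq> {0<..<x'} - {y. t + \<delta> * y \<in> E}"
    by blast
qed

text \<open>The affine map \<open>y \<mapsto> t + \<delta> y\<close> takes \<open>(0, x)\<close> to an interval of radius \<open>\<bar>\<delta>\<bar> x/2 \<ge> x\<^sup>2/2\<close> whose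
  centre lies in a fixed compact interval, so it contains a hole of uniform radius; pulling this
  hole back divides its radius by \<open>\<bar>\<delta>\<bar> \<le> 1/x\<close>.\<close>

lemma hole_radius_exists:
  assumes nd: "interior (closure E) = {}" and x: "0 < x"
  shows "\<exists>\<eta>>0. hole_radius E x \<eta>"
proof -
  obtain \<eta> where \<eta>: "\<eta> > 0"
    and hole: "\<And>m. \<bar>m\<bar> \<le> 1/x + 1 \<Longrightarrow> \<exists>c. ball c \<eta> \<subseteq> ball m (x * x/2) - E"
    using uniform_holes_on_compact[OF nd, of "cball 0 (1/x + 1)" "x * x/2"] x
    by (auto simp: dist_real_def)
  have "hole_radius E x (\<eta> * x)"
    unfolding hole_radius_def
  proof (intro allI impI)
    fix t \<delta> :: real
    assume t: "\<bar>t\<bar> \<le> 1/x" and \<delta>: "x \<le> \<bar>\<delta>\<bar>" "\<bar>\<delta>\<bar> \<le> 1/x"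
    have \<delta>x: "\<bar>\<delta>\<bar> * x \<le> 1"
      using \<delta>(2) x by (simp add: field_simps)
    have "\<bar>\<delta> * (x/2)\<bar> \<le> 1"
      using \<delta>x x by (simp add: abs_mult)
    then have "\<bar>t + \<delta> * (x/2)\<bar> \<le> 1/x + 1"
      using t abs_triangle_ineq[of t "\<delta> * (x/2)"] by linarith
    then obtain c where c: "ball c \<eta> \<subseteq> ball (t + \<delta> * (x/2)) (x * x/2) - E"
      using hole by blast
    have "\<delta> \<noteq> 0"
      using \<delta>(1) x by auto
    define v where "v = (c - t)/\<delta>"
    have c_eq: "c = t + \<delta> * v"
      using \<open>\<delta> \<noteq> 0\<close> by (simp add: v_def)
    have affine_dist: "dist (t + \<delta> * a) (t + \<delta> * b) = \<bar>\<delta>\<bar> * dist a b" for a b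
      by (simp add: dist_real_def flip: abs_mult right_diff_distrib)
    have "y \<in> {0<..<x} - {y. t + \<delta> * y \<in> E}" if "y \<in> ball v (\<eta> * x)" for y
    proof -
      have "\<bar>\<delta>\<bar> * dist v y < \<bar>\<delta>\<bar> * (\<eta> * x)"
        using that \<open>\<delta> \<noteq> 0\<close> by simp
      also have "\<dots> \<le> \<eta>"
        using mult_left_mono[OF \<delta>x, of \<eta>] \<eta> by (simp add: mult_ac)
      finally have "t + \<delta> * y \<in> ball c \<eta>"
        unfolding mem_ball c_eq affine_dist .
      then have y: "t + \<delta> * y \<in> ball (t + \<delta> * (x/2)) (x * x/2)" "t + \<delta> * y \<notin> E"
        using c by auto
      have "x * dist (x/2) y \<le> \<bar>\<delta>\<bar> * dist (x/2) y"
        using \<delta>(1) by (simp add: mult_right_mono)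
      also have "\<dots> < x * (x/2)"
        using y(1) unfolding mem_ball affine_dist by simp
      finally have "dist (x/2) y < x/2"
        using x by (simp only: mult_less_cancel_left_pos)
      then have "0 < y" "y < x"
        unfolding dist_real_def by linarith+
      then show ?thesis
        using y(2) by simp
    qed
    then show "\<exists>v. ball v (\<eta> * x) \<subseteq> {0<..<x} - {y. t + \<delta> * y \<in> E}"
      by blast
  qed
  then show ?thesis
    using \<eta> x by (intro exI[of _ "\<eta> * x"]) simp
qed

text \<open>Half the supremum of the admissible radii inherits monotonicity in the scale and is itself
  admissible; the supremum is finite because a hole of radius \<open>\<eta>\<close> fits into \<open>(0, x)\<close>. The scale is
  restricted to \<open>x \<le> 1\<close> since for \<open>x > 1\<close> there is no \<open>\<delta>\<close> with \<open>x \<le> \<bar>\<delta>\<bar> \<le> 1/x\<close>, and then every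
  radius is admissible.\<close>

lemma monotone_hole_radius:
  assumes nd: "interior (closure E) = {}"
  obtains h :: "real \<Rightarrow> real"
  where "\<And>x. 0 < x \<Longrightarrow> x \<le> 1 \<Longrightarrow> 0 < h x \<and> h x < x \<and> hole_radius E x (h x)"
    and "\<And>x y. 0 < x \<Longrightarrow> x \<le> y \<Longrightarrow> y \<le> 1 \<Longrightarrow> h x \<le> h y"
proof
  define h where "h x = Sup {\<eta>. hole_radius E x \<eta>} / 2" for x
  have le: "\<eta> \<le> x" if x: "0 < x" "x \<le> 1" and \<eta>: "hole_radius E x \<eta>" for x \<eta>
  proof (rule ccontr)
    assume "\<not> \<eta> \<le> x"
    have "1 \<le> 1/x"
      using x by simp
    then obtain v where v: "ball v \<eta> \<subseteq> {0<..<x}"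
      using \<eta>[unfolded hole_radius_def, rule_format, of 0 1] x by auto
    have "v \<in> ball v \<eta>" "v - x \<in> ball v \<eta>"
      using \<open>\<not> \<eta> \<le> x\<close> \<open>0 < x\<close> by (auto simp: dist_real_def)
    then have "v < x" "0 < v - x"
      using v by (meson greaterThanLessThan_iff subsetD)+
    then show False
      by simp
  qed
  have bdd: "bdd_above {\<eta>. hole_radius E x \<eta>}" if "0 < x" "x \<le> 1" for x
    using le[OF that] by (intro bdd_aboveI[of _ x]) auto
  show "0 < h x \<and> h x < x \<and> hole_radius E x (h x)" if x: "0 < x" "x \<le> 1" for x
  proof -
    obtain \<eta> where \<eta>: "\<eta> > 0" "hole_radius E x \<eta>"
      using hole_radius_exists[OF nd x(1)] by blast
    have "\<eta> \<le> 2 * h x"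
      unfolding h_def using cSup_upper[OF _ bdd[OF x]] \<eta>(2) by simp
    then have pos: "0 < h x"
      using \<eta>(1) by linarith
    have "Sup {\<eta>. hole_radius E x \<eta>} \<le> x"
      using \<eta>(2) le[OF x] by (intro cSup_least) auto
    then have "h x < x"
      using x(1) unfolding h_def by simp
    moreover have "h x < Sup {\<eta>. hole_radius E x \<eta>}"
      using pos unfolding h_def by simp
    then obtain \<eta>' where "hole_radius E x \<eta>'" "h x < \<eta>'"
      using less_cSupD[of "{\<eta>. hole_radius E x \<eta>}"] \<eta>(2) by blast
    then have "hole_radius E x (h x)"
      using hole_radius_mono x(1) by (meson less_imp_le order_refl)
    ultimately show ?thesis
      using pos by blast
  qed
  show "h x \<le> h y" if "0 < x" "x \<le> y" "y \<le> 1" for x y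
  proof -
    obtain \<eta> where "hole_radius E x \<eta>"
      using hole_radius_exists[OF nd \<open>0 < x\<close>] by blast
    then have "Sup {\<eta>. hole_radius E x \<eta>} \<le> Sup {\<eta>. hole_radius E y \<eta>}"
      using that hole_radius_mono[OF _ that(1,2) order_refl] bdd[of y]
      by (intro cSup_subset_mono) auto
    then show ?thesis
      unfolding h_def by simp
  qed
qed

text \<open>Walk down from \<open>1\<close>, the step taken at \<open>x\<close> being \<open>h x\<close>. A positive limit \<open>L\<close> would make all
  steps at least \<open>h L\<close>, which is absurd. After reaching \<open>\<alpha> k\<close> no step is longer than \<open>h (\<alpha> k)\<close>, so
  no longer interval below \<open>\<alpha> k\<close> can be jumped over.\<close>

lemma fine_decreasing_sequence:
  fixes h :: "real \<Rightarrow> real"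
  assumes h: "\<And>x. 0 < x \<Longrightarrow> x \<le> 1 \<Longrightarrow> 0 < h x \<and> h x < x"
    and mono: "\<And>x y. 0 < x \<Longrightarrow> x \<le> y \<Longrightarrow> y \<le> 1 \<Longrightarrow> h x \<le> h y"
  obtains \<alpha> :: "nat \<Rightarrow> real"
  where "strict_antimono_on UNIV \<alpha>" "\<alpha> \<longlonglongrightarrow> 0" "\<And>k. 0 < \<alpha> k \<and> \<alpha> k \<le> 1"
    and "\<And>k a b. 0 < b \<Longrightarrow> b \<le> \<alpha> k \<Longrightarrow> h (\<alpha> k) < b - a \<Longrightarrow> \<exists>j>k. a < \<alpha> j \<and> \<alpha> j < b"
proof
  define \<alpha> where "\<alpha> k = ((\<lambda>x. x - h x) ^^ k) 1" for k
  have \<alpha>_Suc: "\<alpha> (Suc k) = \<alpha> k - h (\<alpha> k)" for k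
    by (simp add: \<alpha>_def)
  show bounds: "0 < \<alpha> k \<and> \<alpha> k \<le> 1" for k
  proof (induction k)
    case 0
    show ?case by (simp add: \<alpha>_def)
  next
    case (Suc k)
    then show ?case using h[of "\<alpha> k"] by (simp add: \<alpha>_Suc)
  qed
  have step: "\<alpha> (Suc k) < \<alpha> k" for k
    using h[of "\<alpha> k"] bounds[of k] by (simp add: \<alpha>_Suc)
  have dec: "\<alpha> j \<le> \<alpha> k" if "k \<le> j" for j k
    using lift_Suc_antimono_le[of \<alpha>, OF less_imp_le[OF step] that] .
  have strict: "\<alpha> j < \<alpha> k" if "k < j" for j k
    using dec[of "Suc k" j] step[of k] that by simp
  then show "strict_antimono_on UNIV \<alpha>"
    by (simp add: monotone_on_def)
  show lim: "\<alpha> \<longlonglongrightarrow> 0"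
  proof -
    have "decseq \<alpha>"
      using dec by (simp add: decseq_def)
    then obtain L where L: "\<alpha> \<longlonglongrightarrow> L" "\<And>k. L \<le> \<alpha> k"
      using decseq_convergent[of \<alpha> 0] bounds by (metis less_imp_le)
    have "0 \<le> L"
      using L(1) bounds by (intro LIMSEQ_le_const) (auto intro: less_imp_le)
    moreover have "\<not> 0 < L"
    proof
      assume "0 < L"
      have "L \<le> 1"
        using L(2) bounds by (meson order_trans)
      have "(\<lambda>k. \<alpha> k - \<alpha> (Suc k)) \<longlonglongrightarrow> L - L"
        using L(1) LIMSEQ_Suc by (intro tendsto_diff) auto
      moreover have "h L \<le> \<alpha> k - \<alpha> (Suc k)" for k
        using mono[OF \<open>0 < L\<close> L(2)] bounds[of k] by (simp add: \<alpha>_Suc)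
      ultimately have "h L \<le> L - L"
        by (intro LIMSEQ_le_const) auto
      then show False
        using h[OF \<open>0 < L\<close> \<open>L \<le> 1\<close>] by simp
    qed
    ultimately have "L = 0"
      by simp
    with L(1) show ?thesis
      by simp
  qed
  show "\<exists>j>k. a < \<alpha> j \<and> \<alpha> j < b"
    if b: "0 < b" "b \<le> \<alpha> k" and len: "h (\<alpha> k) < b - a" for k a b
  proof -
    define j where "j = (LEAST j. \<alpha> j < b)"
    have "\<exists>j. \<alpha> j < b"
      using order_tendstoD(2)[OF lim b(1)] by (auto simp: eventually_sequentially)
    then have j: "\<alpha> j < b"
      unfolding j_def by (rule LeastI_ex)
    have "k < j"
      using dec[of j k] j b(2) by (meson leD le_less_trans not_less)
    then obtain i where i: "j = Suc i" "k \<le> i"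
      by (metis less_eq_Suc_le less_Suc_eq_le not0_implies_Suc not_less_zero)
    have "b \<le> \<alpha> i"
      using not_less_Least[of i "\<lambda>j. \<alpha> j < b"] i(1) unfolding j_def by simp
    moreover have "h (\<alpha> i) \<le> h (\<alpha> k)"
      using mono dec[OF i(2)] bounds by blast
    ultimately have "a < \<alpha> j"
      using len by (simp add: i(1) \<alpha>_Suc)
    with j \<open>k < j\<close> show ?thesis
      by blast
  qed
qed

lemma nowhere_dense_avoids_affine_copies:
  fixes E :: "real set"
  assumes nd: "interior (closure E) = {}"
  obtains \<alpha> :: "nat \<Rightarrow> real"
  where "strict_antimono_on UNIV \<alpha>" "\<alpha> \<longlonglongrightarrow> 0" "\<And>t \<delta>. \<delta> \<noteq> 0 \<Longrightarrow> \<exists>j\<ge>1. t + \<delta> * \<alpha> j \<notin> E"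
proof -
  obtain h where h: "\<And>x. 0 < x \<Longrightarrow> x \<le> 1 \<Longrightarrow> 0 < h x \<and> h x < x \<and> hole_radius E x (h x)"
    and mono: "\<And>x y. 0 < x \<Longrightarrow> x \<le> y \<Longrightarrow> y \<le> 1 \<Longrightarrow> h x \<le> h y"
    using monotone_hole_radius[OF nd] by blast
  obtain \<alpha> :: "nat \<Rightarrow> real" where \<alpha>: "strict_antimono_on UNIV \<alpha>" "\<alpha> \<longlonglongrightarrow> 0"
    and bounds: "\<And>k. 0 < \<alpha> k \<and> \<alpha> k \<le> 1"
    and hit: "\<And>k a b. 0 < b \<Longrightarrow> b \<le> \<alpha> k \<Longrightarrow> h (\<alpha> k) < b - a \<Longrightarrow> \<exists>j>k. a < \<alpha> j \<and> \<alpha> j < b"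
    using fine_decreasing_sequence[of h] h mono by blast
  have "\<exists>j\<ge>1. t + \<delta> * \<alpha> j \<notin> E" if "\<delta> \<noteq> 0" for t \<delta>
  proof -
    define e where "e = min \<bar>\<delta>\<bar> (min (1/(1 + \<bar>t\<bar>)) (1/\<bar>\<delta>\<bar>))"
    have "0 < e"
      using that by (simp add: e_def add_pos_nonneg)
    then obtain k where k: "\<alpha> k < e"
      using order_tendstoD(2)[OF \<alpha>(2)] by (auto simp: eventually_sequentially)
    define x where "x = \<alpha> k"
    have x: "0 < x" "x \<le> 1"
      using bounds by (simp_all add: x_def)
    have "x \<le> \<bar>\<delta>\<bar>" and "x \<le> 1/(1 + \<bar>t\<bar>)" and "x \<le> 1/\<bar>\<delta>\<bar>"
      using k by (simp_all add: x_def e_def)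
    then have "x * (1 + \<bar>t\<bar>) \<le> 1" "x * \<bar>\<delta>\<bar> \<le> 1"
      using that by (simp_all add: pos_le_divide_eq add_pos_nonneg)
    then have "\<bar>t\<bar> \<le> 1/x" "\<bar>\<delta>\<bar> \<le> 1/x"
      using x(1) by (simp_all add: pos_le_divide_eq algebra_simps)
    then obtain v where v: "ball v (h x) \<subseteq> {0<..<x} - {y. t + \<delta> * y \<in> E}"
      using h[OF x] \<open>x \<le> \<bar>\<delta>\<bar>\<close> unfolding hole_radius_def by blast
    have hx: "0 < h x"
      using h[OF x] by blast
    have hole: "{v - h x<..<v + h x} \<subseteq> {0<..<x}"
      using v by (auto simp: ball_eq_greaterThanLessThan)
    then have "v + h x \<le> x" "0 \<le> v - h x"
      using hx by (simp_all add: greaterThanLessThan_subseteq_greaterThanLessThan)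
    then obtain j where "j > k" "v - h x < \<alpha> j" "\<alpha> j < v + h x"
      using hit[of "v + h x" k "v - h x"] hx by (auto simp: x_def)
    then have "\<alpha> j \<in> ball v (h x)" and "1 \<le> j"
      by (auto simp: ball_eq_greaterThanLessThan)
    with v show ?thesis
      by blast
  qed
  with \<alpha> that show ?thesis
    by blast
qed

theorem theorem1p1:
  fixes E :: "real set"
  assumes "\<And>\<alpha> :: nat \<Rightarrow> real. strict_antimono_on {1..} \<alpha> \<Longrightarrow> \<alpha> \<longlonglongrightarrow> 0 \<Longrightarrow>
             \<exists>t \<delta> :: real. \<delta> \<noteq> 0 \<and> (\<forall>m\<ge>1. t + \<delta> * \<alpha> m \<in> E)"
  shows "somewhere_dense E"
proof (rule ccontr)
  assume "\<not> somewhere_dense E"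
  then obtain \<alpha> :: "nat \<Rightarrow> real" where \<alpha>: "strict_antimono_on UNIV \<alpha>" "\<alpha> \<longlonglongrightarrow> 0"
    and avoid: "\<And>t \<delta>. \<delta> \<noteq> 0 \<Longrightarrow> \<exists>j\<ge>1. t + \<delta> * \<alpha> j \<notin> E"
    using nowhere_dense_avoids_affine_copies
      interior_closure_empty_if_not_somewhere_dense by blast
  have "strict_antimono_on {1..} \<alpha>"
    using \<alpha>(1) by (rule monotone_on_subset) simp
  from assms[OF this \<alpha>(2)] avoid show False
    by blast
qed

end
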